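(* Let $X$ be a hermetic metric space, and let $a>b>1$ be real numbers such that $$\frac{2b}{a-b}+\frac{1}{b-1}<\frac{H(X)}{8}.$$ Let $f\colon X\to\mathbb{R}$ be a Takagi--van der Waerden function of type $(a,b)$. Then $\operatorname{lip} f(x)=\infty$ for every non-isolated point $x$ of $X$.
   Context: The metric on $X$ is denoted $|\cdot-\cdot|_X$, $B(x,r)=\{u\in X:|u-x|_X<r\}$, and $d(x,A)=\inf_{y\in A}|x-y|_X$ for $x\in X$, $A\subseteq X$. $X^d$ is the set of non-isolated points of $X$. Hermeticity: for $x\in X$ put $H(X,x)=\liminf_{r\to0^+}\frac1r\sup_{u\in B(x,r)}|u-x|_X$, and $H(X)=\inf_{x\in X^d}H(X,x)$ (infimum in $[0,+\infty]$, so that $\inf\varnothing=+\infty$). The space $X$ is hermetic if $H(X)>0$. For $\varepsilon>0$, a set $S\subseteq X$ is $\varepsilon$-separated if $|x-y|_X\ge\varepsilon$ for all distinct $x,y\in S$; it is maximal $\varepsilon$-separated if it is $\varepsilon$-separated and every $\varepsilon$-separated set $T\subseteq X$ with $S\subseteq T$ satisfies $T=S$. For $a>b>0$, a function $f\colon X\to\mathbb{R}$ is a Takagi--van der Waerden function of type $(a,b)$ if there is a sequence $(S_n)_{n=0}^\infty$, where each $S_n$ is a maximal $\frac1{a^n}$-separated set in $X$, such that $f(x)=\sum_{n=0}^\infty b^n d(x,S_n)$ for all $x\in X$ (the sets $S_n$ are not required to be increasing). The little Lipschitz derivative of $f\colon X\to\mathbb{R}$ at $x$ is $\operatorname{lip}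 f(x)=\liminf_{r\to0^+}\sup_{u\in B(x,r)}\frac1r|f(u)-f(x)|\in[0,+\infty]$. *)

theory Defs
  imports "HOL-Analysis.Analysis"
begin

text \<open>
  The metric space \<open>X\<close> is a type \<open>'a\<close> of class \<^class>\<open>metric_space\<close>. Quantities that may
  be infinite take values in \<^typ>\<open>ereal\<close>; they are all non-negative.
\<close>

definition nonisolated_points :: "'a::metric_space set" where
  "nonisolated_points = {x. \<not> x isolated_in UNIV}"

definition hermeticity_at :: "'a::metric_space \<Rightarrow> ereal" where
  "hermeticity_at x =
     Liminf (at_right (0::real)) (\<lambda>r. ereal (1 / r) * (SUP u\<in>ball x r. ereal (dist u x)))"

text \<open>The infimum over the empty set is \<open>\<infinity>\<close>, so a discrete space has hermeticity \<open>\<infinity>\<close>.\<close>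

definition hermeticity :: "'a::metric_space itself \<Rightarrow> ereal" where
  "hermeticity _ = (INF x\<in>(nonisolated_points :: 'a set). hermeticity_at x)"

definition hermetic :: "'a::metric_space itself \<Rightarrow> bool" where
  "hermetic X \<longleftrightarrow> hermeticity X > 0"

definition eps_separated :: "real \<Rightarrow> 'a::metric_space set \<Rightarrow> bool" where
  "eps_separated \<epsilon> S \<longleftrightarrow> (\<forall>x\<in>S. \<forall>y\<in>S. x \<noteq> y \<longrightarrow> dist x y \<ge> \<epsilon>)"

definition maximal_eps_separated :: "real \<Rightarrow> 'a::metric_space set \<Rightarrow> bool" where
  "maximal_eps_separated \<epsilon> S \<longleftrightarrow>
     eps_separated \<epsilon> S \<and> (\<forall>T. eps_separated \<epsilon> T \<and> S \<subseteq> T \<longrightarrow> T = S)"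

text \<open>
  A maximal separated set in a nonempty space is nonempty, so the library convention that
  \<^const>\<open>infdist\<close> to the empty set is \<open>0\<close> plays no role here.
\<close>

definition takagi_van_der_waerden :: "real \<Rightarrow> real \<Rightarrow> ('a::metric_space \<Rightarrow> real) \<Rightarrow> bool" where
  "takagi_van_der_waerden a b f \<longleftrightarrow> a > b \<and> b > 0 \<and>
     (\<exists>S :: nat \<Rightarrow> 'a set. (\<forall>n. maximal_eps_separated (1 / a ^ n) (S n)) \<and>
        (\<forall>x. (\<lambda>n. b ^ n * infdist x (S n)) sums f x))"

definition little_lip :: "('a::metric_space \<Rightarrow> real) \<Rightarrow> 'a \<Rightarrow> ereal" where
  "little_lip f x =
     Liminf (at_right (0::real)) (\<lambda>r. SUP u\<in>ball x r. ereal (1 / r * \<bar>f u - f x\<bar>))"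

end

theory Submission
  imports Defs
begin

text \<open>
  At scale \<open>1 / a ^ n\<close> the summand \<open>b ^ n * d(\<cdot>, S\<^sub>n)\<close> dominates the increment of \<open>f\<close>: the earlier
  summands are Lipschitz with total constant below \<open>b ^ n / (b - 1)\<close>, and the later ones are
  bounded by a geometric tail. Its own oscillation near \<open>x\<close> is at least a fixed
  multiple of \<open>(b / a) ^ n\<close>: if \<open>x\<close> is far from \<open>S\<^sub>n\<close>, compare it with a nearby point of \<open>S\<^sub>n\<close>; if
  \<open>x\<close> is close to \<open>S\<^sub>n\<close>, hermeticity at \<open>x\<close> gives a point \<open>u\<close> that moves away from \<open>x\<close>, hence from
  \<open>S\<^sub>n\<close>, without reaching another point of \<open>S\<^sub>n\<close>. Dividing by the scale leaves a factor \<open>b ^ n\<close>,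
  which tends to infinity.
\<close>

lemma infdist_lessE:
  assumes "infdist x S < t" "S \<noteq> {}"
  obtains s where "s \<in> S" "dist x s < t"
  using assms by (auto simp: infdist_notempty cInf_less_iff)

lemma maximal_eps_separated_near:
  assumes "maximal_eps_separated \<epsilon> S" "\<epsilon> > 0"
  obtains s where "s \<in> S" "dist x s < \<epsilon>"
proof -
  have "\<exists>s\<in>S. dist x s < \<epsilon>"
  proof (rule ccontr)
    assume far: "\<not> ?thesis"
    then have "eps_separated \<epsilon> (insert x S)"
      using assms unfolding maximal_eps_separated_def eps_separated_def
      by (auto simp: dist_commute not_less)
    then have "insert x S = S"
      using assms unfolding maximal_eps_separated_def by blast
    with far assms(2) show False by force
  qed
  with that show ?thesis by blast
qed

lemma infdist_maximal_eps_separated_less: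
  assumes "maximal_eps_separated \<epsilon> S" "\<epsilon> > 0"
  shows "infdist x S < \<epsilon>"
  using maximal_eps_separated_near[OF assms] infdist_le by (metis le_less_trans)

text \<open>If \<open>x\<close> is far from \<open>S\<close>, the witness is a point of
  \<open>S\<close> within \<epsilon> of \<open>x\<close>, where \<open>infdist\<close> vanishes.
  Otherwise it is \<open>v\<close>: the lower bound on \<open>dist v x\<close> keeps
  \<open>v\<close> away from the point of \<open>S\<close> close to \<open>x\<close>, the upper
  bound keeps it away from all others.\<close>

lemma maximal_eps_separated_oscillation:
  fixes x :: "'a::metric_space"
  assumes S: "maximal_eps_separated \<epsilon> S" and "\<epsilon> > 0"
    and v: "4 * e * \<epsilon> < dist v x" "dist v x < \<epsilon> / 2"
  obtains u where "dist u x < \<epsilon>" "e * \<epsilon> \<le> \<bar>infdist u S - infdist x S\<bar>"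
proof (cases "e * \<epsilon> \<le> infdist x S")
  case True
  obtain s where s: "s \<in> S" "dist x s < \<epsilon>"
    using maximal_eps_separated_near[OF S \<open>\<epsilon> > 0\<close>] .
  show thesis
    using that[of s] True s by (simp add: dist_commute)
next
  case False
  have "S \<noteq> {}"
    using maximal_eps_separated_near[OF S \<open>\<epsilon> > 0\<close>] by blast
  then obtain s where s: "s \<in> S" "dist x s < e * \<epsilon>"
    using infdist_lessE False by (metis not_le)
  have e: "8 * (e * \<epsilon>) < \<epsilon>"
    using v by linarith
  have "2 * (e * \<epsilon>) \<le> dist v s'" if "s' \<in> S" for s'
  proof (cases "s' = s")
    case True
    show ?thesis
      unfolding True
      using dist_triangle[of v x s] zero_le_dist[of x s] dist_commute[of s x] s v by argo
  next
    case neq: False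
    then have "\<epsilon> \<le> dist s s'"
      using S s that unfolding maximal_eps_separated_def eps_separated_def by metis
    \<comment> \<open>The detour from \<open>s\<close> through \<open>x\<close> and \<open>v\<close>
      to \<open>s'\<close> has length at least \<epsilon>, so \<open>dist v s'\<close> exceeds
      \<open>\<epsilon> / 2 - e * \<epsilon>\<close>, which by \<open>e\<close> is more than
      \<open>3 * (e * \<epsilon>)\<close>.\<close>
    then show ?thesis
      using dist_triangle[of s s' x] dist_triangle[of x s' v]
        zero_le_dist[of x s] dist_commute[of s x] dist_commute[of x v] s v e
      by linarith
  qed
  then have "2 * (e * \<epsilon>) \<le> infdist v S"
    using \<open>S \<noteq> {}\<close> by (simp add: infdist_notempty cINF_greatest)
  moreover have "infdist x S < e * \<epsilon>"
    using False by simp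
  ultimately have "e * \<epsilon> \<le> \<bar>infdist v S - infdist x S\<bar>"
    by linarith
  then show thesis
    using that[of v] v \<open>\<epsilon> > 0\<close> by simp
qed

text \<open>The series of increments is split into the terms before, at and after index
  \<open>n\<close>. Since \<open>infdist\<close> is 1-Lipschitz, the first block costs a finite
  geometric sum times \<open>dist u x\<close>.\<close>

lemma takagi_increment_ge:
  fixes f :: "'a::metric_space \<Rightarrow> real"
  assumes ab: "a > b" "b > 1"
    and S: "\<And>n. maximal_eps_separated (1 / a ^ n) (S n)"
    and f: "\<And>x. (\<lambda>n. b ^ n * infdist x (S n)) sums f x"
  shows "b ^ n * \<bar>infdist u (S n) - infdist x (S n)\<bar> - b ^ n / (b - 1) * dist u x
           - (b / a) ^ n * (b / (a - b)) \<le> \<bar>f u - f x\<bar>"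
proof -
  define g where "g k = b ^ k * (infdist u (S k) - infdist x (S k))" for k
  have "g sums (f u - f x)"
    using sums_diff[OF f[of u] f[of x]] by (simp add: g_def[abs_def] algebra_simps)
  then have tail: "(\<lambda>k. g (k + Suc n)) sums (f u - f x - sum g {..<Suc n})"
    by (rule sums_split_initial_segment)
  have small: "\<bar>infdist y (S k)\<bar> < 1 / a ^ k" for y k
    using infdist_maximal_eps_separated_less[OF S[of k], of y] ab infdist_nonneg[of y "S k"] by simp
  have gk: "\<bar>g k\<bar> \<le> (b / a) ^ k" for k
  proof -
    \<comment> \<open>Both distances lie between 0 and \<open>1 / a ^ k\<close>, so their difference
      is bounded by \<open>1 / a ^ k\<close> without a factor 2.\<close>
    have "\<bar>infdist u (S k) - infdist x (S k)\<bar> \<le> 1 / a ^ k"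
      using small[of u k] small[of x k] infdist_nonneg[of u "S k"] infdist_nonneg[of x "S k"]
      by linarith
    then have "b ^ k * \<bar>infdist u (S k) - infdist x (S k)\<bar> \<le> b ^ k * (1 / a ^ k)"
      using ab by (intro mult_left_mono) auto
    then show ?thesis
      using ab by (simp add: g_def abs_mult power_divide)
  qed
  have "(\<lambda>k. (b / a) ^ Suc n * (b / a) ^ k) sums ((b / a) ^ Suc n * (1 / (1 - b / a)))"
    using ab by (intro sums_mult geometric_sums) simp
  also have "(b / a) ^ Suc n * (1 / (1 - b / a)) = (b / a) ^ n * (b / (a - b))"
    using ab by (simp add: field_simps)
  finally have geo: "(\<lambda>k. (b / a) ^ (k + Suc n)) sums ((b / a) ^ n * (b / (a - b)))"
    by (simp add: power_add mult_ac)
  have T: "\<bar>f u - f x - sum g {..<Suc n}\<bar> \<le> (b / a) ^ n * (b / (a - b))"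
    using norm_sums_le[OF tail geo] gk by (metis real_norm_def)
  have "\<bar>sum g {..<n}\<bar> \<le> (\<Sum>k<n. b ^ k * dist u x)"
  proof (rule order_trans[OF sum_abs sum_mono])
    fix k
    show "\<bar>g k\<bar> \<le> b ^ k * dist u x"
      using ab infdist_triangle_abs[of u "S k" x] by (simp add: g_def abs_mult)
  qed
  also have "\<dots> = (b ^ n - 1) / (b - 1) * dist u x"
    using ab by (simp add: sum_distrib_right[symmetric] geometric_sum)
  also have "\<dots> \<le> b ^ n / (b - 1) * dist u x"
    using ab by (intro mult_right_mono divide_right_mono) auto
  finally have L: "\<bar>sum g {..<n}\<bar> \<le> b ^ n / (b - 1) * dist u x" .
  have "\<bar>g n\<bar> = b ^ n * \<bar>infdist u (S n) - infdist x (S n)\<bar>"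
    using ab by (simp add: g_def abs_mult)
  moreover have "sum g {..<Suc n} = sum g {..<n} + g n"
    by simp
  ultimately show ?thesis
    using T L by linarith
qed

text \<open>Turns the liminf into actual points: if no point of the ball were farther than
  \<open>c * r\<close> from \<open>x\<close>, the supremum would be at most
  \<open>c * r\<close>.\<close>

lemma hermeticity_at_greaterD:
  fixes x :: "'a::metric_space"
  assumes "ereal c < hermeticity_at x"
  shows "\<forall>\<^sub>F r in at_right 0. \<exists>u. c * r < dist u x \<and> dist u x < r"
proof -
  have "\<forall>\<^sub>F r in at_right 0. ereal c < ereal (1 / r) * (SUP u\<in>ball x r. ereal (dist u x))"
    using assms unfolding hermeticity_at_def by (rule less_LiminfD)
  moreover have "\<forall>\<^sub>F r in at_right (0::real). 0 < r"
    by (rule eventually_at_right_less)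
  ultimately show ?thesis
  proof eventually_elim
    case (elim r)
    show ?case
    proof (rule ccontr)
      assume "\<not> ?case"
      then have "(SUP u\<in>ball x r. ereal (dist u x)) \<le> ereal (c * r)"
        by (intro SUP_least) (auto simp: dist_commute not_less)
      then have "ereal (1 / r) * (SUP u\<in>ball x r. ereal (dist u x)) \<le> ereal (1 / r) * ereal (c * r)"
        using elim(2) by (intro ereal_mult_left_mono) auto
      with elim show False by simp
    qed
  qed
qed

text \<open>The least \<open>m\<close> with \<open>1 / a ^ m \<le> r\<close> exceeds
  \<open>N\<close>, so it has a predecessor \<open>n \<ge> N\<close>, at which the inequality
  fails.\<close>

lemma inverse_power_scale:
  fixes a r :: real
  assumes "a > 1" "0 < r" "r < 1 / a ^ N"
  obtains n where "N \<le> n" "1 / a ^ Suc n \<le> r" "r < 1 / a ^ n"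
proof -
  define m where "m = (LEAST m. 1 / a ^ m \<le> r)"
  obtain k where "(1 / a) ^ k < r"
    using real_arch_pow_inv[of r "1 / a"] assms by auto
  then have ex: "1 / a ^ k \<le> r"
    by (simp add: power_divide)
  have m: "1 / a ^ m \<le> r"
    unfolding m_def using ex by (rule LeastI)
  have less: "r < 1 / a ^ j" if "j < m" for j
    using not_less_Least[of j] that unfolding m_def by (meson not_le)
  have "N < m"
  proof (rule ccontr)
    assume "\<not> N < m"
    then have "a ^ m \<le> a ^ N"
      using assms by (intro power_increasing) auto
    then have "1 / a ^ N \<le> 1 / a ^ m"
      using assms by (intro divide_left_mono) auto
    with m assms show False by linarith
  qed
  then obtain n where "m = Suc n" "N \<le> n"
    by (metis Suc_le_D Suc_le_eq Suc_le_mono)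
  with that m less show ?thesis by blast
qed

text \<open>With \<open>dist u x < 1 / a ^ n\<close>, the gain and both losses are all multiples of
  \<open>(b / a) ^ n\<close>, so only their constants compete.\<close>

lemma takagi_large_increment:
  fixes f :: "'a::metric_space \<Rightarrow> real"
  assumes ab: "a > b" "b > 1"
    and S: "\<And>n. maximal_eps_separated (1 / a ^ n) (S n)"
    and f: "\<And>x. (\<lambda>n. b ^ n * infdist x (S n)) sums f x"
    and v: "4 * e / a ^ n < dist v x" "dist v x < 1 / a ^ n / 2"
  obtains u where "dist u x < 1 / a ^ n"
    "(b / a) ^ n * (e - 1 / (b - 1) - b / (a - b)) \<le> \<bar>f u - f x\<bar>"
proof -
  have "4 * e * (1 / a ^ n) < dist v x"
    using v by simp
  then obtain u where u: "dist u x < 1 / a ^ n"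
      "e * (1 / a ^ n) \<le> \<bar>infdist u (S n) - infdist x (S n)\<bar>"
    using maximal_eps_separated_oscillation[OF S _ _ v(2)] ab by auto
  have "b ^ n / (b - 1) * dist u x \<le> b ^ n / (b - 1) * (1 / a ^ n)"
    using u ab by (intro mult_left_mono) auto
  moreover have "b ^ n * (e * (1 / a ^ n)) \<le> b ^ n * \<bar>infdist u (S n) - infdist x (S n)\<bar>"
    using u ab by (intro mult_left_mono) auto
  moreover have "b ^ n * (e * (1 / a ^ n)) - b ^ n / (b - 1) * (1 / a ^ n)
      - (b / a) ^ n * (b / (a - b)) = (b / a) ^ n * (e - 1 / (b - 1) - b / (a - b))"
    by (simp add: power_divide algebra_simps)
  ultimately show thesis
    using that[of u] u takagi_increment_ge[OF ab S f, of n u x] by linarith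
qed

lemma little_lip_takagi_at:
  fixes f :: "'a::metric_space \<Rightarrow> real"
  assumes ab: "a > b" "b > 1"
    and e: "b / (a - b) + 1 / (b - 1) < e" "ereal (8 * e) < hermeticity_at x"
    and tak: "takagi_van_der_waerden a b f"
  shows "little_lip f x = \<infinity>"
proof -
  obtain S where S: "\<And>n. maximal_eps_separated (1 / a ^ n) (S n)"
    and f: "\<And>x. (\<lambda>n. b ^ n * infdist x (S n)) sums f x"
    using tak unfolding takagi_van_der_waerden_def by blast
  define \<kappa> where "\<kappa> = e - 1 / (b - 1) - b / (a - b)"
  have \<kappa>: "\<kappa> > 0"
    using e by (simp add: \<kappa>_def)
  obtain \<rho> where \<rho>: "\<rho> > 0" "\<And>r. 0 < r \<Longrightarrow> r < \<rho> \<Longrightarrow> \<exists>u. 8 * e * r < dist u x \<and> dist u x < r"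
    using hermeticity_at_greaterD[OF e(2)] unfolding eventually_at_right_field by auto
  have "ereal M \<le> little_lip f x" for M
    unfolding little_lip_def
  proof (rule Liminf_bounded)
    \<comment> \<open>Chosen so that the final lower bound \<open>b ^ Suc n * \<kappa> / a\<close>
      for the difference quotient is at least \<open>M\<close> whenever
      \<open>n \<ge> N1\<close>.\<close>
    obtain N1 where N1: "M * a / \<kappa> < b ^ N1"
      using real_arch_pow[OF \<open>b > 1\<close>] by blast
    define \<delta> where "\<delta> = min \<rho> (1 / a ^ N1)"
    have "\<forall>\<^sub>F r in at_right 0. 0 < r \<and> r < \<delta>"
      using \<rho> ab by (auto simp: eventually_at_right_field \<delta>_def intro!: exI[of _ \<delta>])
    then show "\<forall>\<^sub>F r in at_right 0. ereal M \<le> (SUP u\<in>ball x r. ereal (1 / r * \<bar>f u - f x\<bar>))"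
    proof eventually_elim
      case (elim r)
      then obtain n where n: "N1 \<le> n" "1 / a ^ Suc n \<le> r" "r < 1 / a ^ n"
        using inverse_power_scale[of a r N1] ab by (auto simp: \<delta>_def)
      \<comment> \<open>The finer scale \<open>Suc n\<close> is used because
        \<open>s \<le> r\<close> keeps the witness in \<open>ball x r\<close>; as
        \<open>r < 1 / a ^ n\<close>, this costs at most a factor \<open>a\<close>.\<close>
      define s where "s = 1 / a ^ Suc n"
      have s: "s > 0" "s \<le> r"
        using n ab by (auto simp: s_def)
      \<comment> \<open>Taking the radius \<open>s / 2\<close> gives the upper bound needed on
        \<open>dist v x\<close> and turns the constant 8 into 4.\<close>
      then have "\<exists>v. 8 * e * (s / 2) < dist v x \<and> dist v x < s / 2"
        using \<rho>(2)[of "s / 2"] elim by (simp add: \<delta>_def)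
      then obtain v where v: "4 * e * s < dist v x" "dist v x < s / 2"
        by (auto simp: mult.assoc)
      obtain u where u: "dist u x < 1 / a ^ Suc n"
          "(b / a) ^ Suc n * \<kappa> \<le> \<bar>f u - f x\<bar>"
        using takagi_large_increment[OF ab S f, of e "Suc n" v x] v
        by (auto simp: s_def \<kappa>_def)
      have "b ^ N1 \<le> b ^ Suc n"
        using n ab by (intro power_increasing) auto
      then have "M * a / \<kappa> \<le> b ^ Suc n"
        using N1 by linarith
      then have M: "M \<le> b ^ Suc n * \<kappa> / a"
        using \<kappa> ab by (simp add: field_simps)
      have "b ^ Suc n * \<kappa> / a * r \<le> b ^ Suc n * \<kappa> / a * (1 / a ^ n)"
        using n \<kappa> ab by (intro mult_left_mono) auto
      also have "\<dots> = (b / a) ^ Suc n * \<kappa>"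
        by (simp add: power_divide)
      finally have "M * r \<le> \<bar>f u - f x\<bar>"
        using u M elim mult_right_mono[OF M, of r] by linarith
      then have "ereal M \<le> ereal (1 / r * \<bar>f u - f x\<bar>)"
        using elim by (simp add: field_simps)
      moreover have "u \<in> ball x r"
        using u n by (simp add: dist_commute)
      ultimately show ?case
        by (meson SUP_upper2)
    qed
  qed
  then show ?thesis
    by (rule ereal_top)
qed

theorem theorem6p5:
  fixes f :: "'a::metric_space \<Rightarrow> real" and a b :: real
  assumes "hermetic TYPE('a)"
    and "a > b" and "b > 1"
    and "ereal (2 * b / (a - b) + 1 / (b - 1)) < hermeticity TYPE('a) / 8"
    and "takagi_van_der_waerden a b f"
  shows "\<forall>x \<in> nonisolated_points. little_lip f x = \<infinity>"
proof
  fix x :: 'a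
  assume x: "x \<in> nonisolated_points"
  \<comment> \<open>A real \<open>e\<close> strictly in between gives a finite constant to work with
    even if the hermeticity is infinite.\<close>
  obtain e where e: "ereal (2 * b / (a - b) + 1 / (b - 1)) < ereal e"
      "ereal e < hermeticity TYPE('a) / 8"
    using ereal_dense2[OF assms(4)] by blast
  have "ereal (8 * e) < hermeticity TYPE('a)"
    using e(2) by (cases "hermeticity TYPE('a)") auto
  also have "\<dots> \<le> hermeticity_at x"
    using x unfolding hermeticity_def by (rule INF_lower)
  finally have "ereal (8 * e) < hermeticity_at x" .
  moreover have "b / (a - b) + 1 / (b - 1) < e"
  proof -
    have "b / (a - b) \<le> 2 * b / (a - b)"
      using assms by (intro divide_right_mono) auto
    with e(1) show ?thesis by simp
  qed
  ultimately show "little_lip f x = \<infinity>"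
    using little_lip_takagi_at assms by blast
qed

end
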